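(* Let $\{(x^k,y^k)\}_{k\in\mathbb{N}_0}$ be the iterates generated by the difference-of-$\Phi$-convex algorithm ($\Phi$-DCA). Then the following sufficient decrease property holds for all $k\in\mathbb{N}_0$: $$F(x^{k+1})=F(x^k)-\big(\operatorname{gap}_g^\Phi(x^k,y^k)+\operatorname{gap}_f^\Phi(y^k,x^{k+1})\big),$$ i.e. the sequence of function values $\{F(x^k)\}_{k\in\mathbb{N}_0}$ is nonincreasing.
   Context: Setting. $X\subseteq\mathbb{R}^n$ and $Y\subseteq\mathbb{R}^m$ are nonempty and $\Phi:X\times Y\to\mathbb{R}$ is jointly continuous relative to $X\times Y$. $\overline{\mathbb{R}}=\mathbb{R}\cup\{\pm\infty\}$. A function is proper if it never takes the value $-\infty$ and is not identically $+\infty$. A function $f:X\to\overline{\mathbb{R}}$ is $\Phi$-convex if there are an index set $I$ and $(y_i,\beta_i)\in Y\times\overline{\mathbb{R}}$, $i\in I$, with $f(x)=\sup_{i\in I}\Phi(x,y_i)-\beta_i$ for all $x\in X$ (and $f\equiv-\infty$ if $I=\emptyset$). Standing assumptions: $f:X\to\overline{\mathbb{R}}$ is proper and $\Phi$-convex; $g:X\to\overline{\mathbb{R}}$ is proper and lower semicontinuous relative to $X$, and there exist $y\in Y$, $\beta\in\mathbb{R}$ with $g\ge\Phi(\cdot,y)-\beta$ on $X$; $F:=g-f$ (with the convention $g(x)-f(x)=+\infty$ if both values are $+\infty$) satisfies $-\infty<\inf_X F<\infty$. $\Phi$-conjugate: for $\varphi:X\to\overline{\mathbb{R}}$, $\varphi^\Phi(y)=\sup_{x\in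 X}\Phi(x,y)-\varphi(x)$. $\Phi$-subdifferential: $y\in\partial_\Phi\varphi(\bar x)$ iff $y\in Y$ and $\varphi(x)\ge\varphi(\bar x)+\Phi(x,y)-\Phi(\bar x,y)$ for all $x\in X$. Inverse: $(\partial_\Phi g)^{-1}(y)=\{x\in X:y\in\partial_\Phi g(x)\}=\operatorname{argmin}_{x\in X}\{g(x)-\Phi(x,y)\}$. $\Phi$-DCA: starting from $x^0\in\operatorname{dom}\partial_\Phi f=\{x:\partial_\Phi f(x)\neq\emptyset\}$, for $k\in\mathbb{N}_0$ choose $y^k\in\partial_\Phi f(x^k)$ and $x^{k+1}\in(\partial_\Phi g)^{-1}(y^k)$. For well-definedness it is assumed that $\emptyset\ne\operatorname{rge}(\partial_\Phi g)^{-1}\subseteq\operatorname{dom}\partial_\Phi f$ and $\emptyset\neq\operatorname{rge}\partial_\Phi f\subseteq\operatorname{dom}(\partial_\Phi g)^{-1}$ (dom = set of points with nonempty image, rge = union of all images). Gap functions: $\operatorname{gap}_g^\Phi(x,y)=g(x)+g^\Phi(y)-\Phi(x,y)$ and $\operatorname{gap}_f^\Phi(y,x)=f(x)+f^\Phi(y)-\Phi(x,y)$.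
   Formalization: If g(x^0) = +∞ the displayed identity at k = 0 reads ∞ − ∞, so there it is replaced by F(x^1) + (gap_g + gap_f) = F(x^0); this additive form and the monotonicity of F(x^k) are proved for all k. *)

theory Defs
  imports "HOL-Analysis.Analysis"
begin

text \<open>
  A function on a set \<open>X\<close> is represented by a total function of which only the values on \<open>X\<close>
  matter.  Differences are those of \<^typ>\<open>ereal\<close>, where \<open>\<infinity> - \<infinity> = \<infinity>\<close>.
\<close>

definition proper_on :: "'a set \<Rightarrow> ('a \<Rightarrow> ereal) \<Rightarrow> bool" where
  "proper_on X \<phi> \<longleftrightarrow> (\<forall>x\<in>X. \<phi> x \<noteq> - \<infinity>) \<and> (\<exists>x\<in>X. \<phi> x \<noteq> \<infinity>)"

text \<open>At an isolated point of \<open>X\<close> the Liminf below is \<open>\<infinity>\<close>, so the condition is void there.\<close>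

definition lsc_on :: "'a::topological_space set \<Rightarrow> ('a \<Rightarrow> ereal) \<Rightarrow> bool" where
  "lsc_on X \<phi> \<longleftrightarrow> (\<forall>x\<in>X. \<phi> x \<le> Liminf (at x within X) \<phi>)"

text \<open>
  The index type \<^typ>\<open>'b \<times> ereal\<close> is no restriction: a supremum depends only on the set of pairs
  \<open>(y i, \<beta> i)\<close> that occur, and this set can index itself.  For \<open>I = {}\<close> the supremum is \<open>- \<infinity>\<close>.
\<close>

definition Phi_convex_on ::
  "'a set \<Rightarrow> 'b set \<Rightarrow> ('a \<Rightarrow> 'b \<Rightarrow> real) \<Rightarrow> ('a \<Rightarrow> ereal) \<Rightarrow> bool" where
  "Phi_convex_on X Y \<Phi> \<phi> \<longleftrightarrow>
     (\<exists>(I :: ('b \<times> ereal) set) (y :: 'b \<times> ereal \<Rightarrow> 'b) (\<beta> :: 'b \<times> ereal \<Rightarrow> ereal).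
        (\<forall>i\<in>I. y i \<in> Y) \<and> (\<forall>x\<in>X. \<phi> x = (SUP i\<in>I. ereal (\<Phi> x (y i)) - \<beta> i)))"

definition Phi_conj ::
  "'a set \<Rightarrow> ('a \<Rightarrow> 'b \<Rightarrow> real) \<Rightarrow> ('a \<Rightarrow> ereal) \<Rightarrow> 'b \<Rightarrow> ereal" where
  "Phi_conj X \<Phi> \<phi> y = (SUP x\<in>X. ereal (\<Phi> x y) - \<phi> x)"

definition Phi_subdiff ::
  "'a set \<Rightarrow> 'b set \<Rightarrow> ('a \<Rightarrow> 'b \<Rightarrow> real) \<Rightarrow> ('a \<Rightarrow> ereal) \<Rightarrow> 'a \<Rightarrow> 'b set" where
  "Phi_subdiff X Y \<Phi> \<phi> xb =
     {y \<in> Y. \<forall>x\<in>X. \<phi> x \<ge> \<phi> xb + ereal (\<Phi> x y) - ereal (\<Phi> xb y)}"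

definition Phi_subdiff_inv ::
  "'a set \<Rightarrow> 'b set \<Rightarrow> ('a \<Rightarrow> 'b \<Rightarrow> real) \<Rightarrow> ('a \<Rightarrow> ereal) \<Rightarrow> 'b \<Rightarrow> 'a set" where
  "Phi_subdiff_inv X Y \<Phi> \<phi> y = {x \<in> X. y \<in> Phi_subdiff X Y \<Phi> \<phi> x}"

definition dom_on :: "'a set \<Rightarrow> ('a \<Rightarrow> 'b set) \<Rightarrow> 'a set" where
  "dom_on A S = {a \<in> A. S a \<noteq> {}}"

definition rge_on :: "'a set \<Rightarrow> ('a \<Rightarrow> 'b set) \<Rightarrow> 'b set" where
  "rge_on A S = (\<Union>a\<in>A. S a)"

definition gap_g ::
  "'a set \<Rightarrow> ('a \<Rightarrow> 'b \<Rightarrow> real) \<Rightarrow> ('a \<Rightarrow> ereal) \<Rightarrow> 'a \<Rightarrow> 'b \<Rightarrow> ereal" where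
  "gap_g X \<Phi> g x y = g x + Phi_conj X \<Phi> g y - ereal (\<Phi> x y)"

definition gap_f ::
  "'a set \<Rightarrow> ('a \<Rightarrow> 'b \<Rightarrow> real) \<Rightarrow> ('a \<Rightarrow> ereal) \<Rightarrow> 'b \<Rightarrow> 'a \<Rightarrow> ereal" where
  "gap_f X \<Phi> f y x = f x + Phi_conj X \<Phi> f y - ereal (\<Phi> x y)"

definition Phi_DCA_iterates ::
  "'a set \<Rightarrow> 'b set \<Rightarrow> ('a \<Rightarrow> 'b \<Rightarrow> real) \<Rightarrow> ('a \<Rightarrow> ereal) \<Rightarrow> ('a \<Rightarrow> ereal)
     \<Rightarrow> (nat \<Rightarrow> 'a) \<Rightarrow> (nat \<Rightarrow> 'b) \<Rightarrow> bool" where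
  "Phi_DCA_iterates X Y \<Phi> g f x y \<longleftrightarrow>
     x 0 \<in> dom_on X (Phi_subdiff X Y \<Phi> f) \<and>
     (\<forall>k. y k \<in> Phi_subdiff X Y \<Phi> f (x k) \<and> x (Suc k) \<in> Phi_subdiff_inv X Y \<Phi> g (y k))"

end

theory Submission
  imports Defs
begin

text \<open>
  The identity is a cancellation.  A subgradient \<open>v\<close> of a proper function \<open>\<phi>\<close> at \<open>u\<close> forces
  \<open>\<phi> u\<close> to be finite and turns the Fenchel--Young inequality \<open>\<phi> u + \<phi>\<^sup>\<Phi> v \<ge> \<Phi> u v\<close> into an
  equality (\<open>Phi_subdiff_finite\<close>, \<open>Phi_conj_at_subgradient\<close>).  One step from \<open>u = x k\<close> to
  \<open>u' = x (Suc k)\<close> uses a single \<open>v = y k\<close> which is a subgradient of \<open>f\<close> at \<open>u\<close> and of \<open>g\<close> at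
  \<open>u'\<close>, so that
  \<open>f\<^sup>\<Phi> v = \<Phi> u v - f u\<close> and \<open>g\<^sup>\<Phi> v = \<Phi> u' v - g u'\<close>.  In the sum of the two gaps,
  \<open>g u + g\<^sup>\<Phi> v - \<Phi> u v\<close> and \<open>f u' + f\<^sup>\<Phi> v - \<Phi> u' v\<close>, the values of \<open>\<Phi>\<close> cancel and
  \<open>(g u - f u) - (g u' - f u')\<close> remains.

  The values \<open>f u\<close>, \<open>f u'\<close> and \<open>g u'\<close> are finite because each of them is taken at a point with a
  subgradient.  Only \<open>g u\<close> may be infinite, and only at the starting point, since every later
  iterate has a subgradient of \<open>g\<close>.  In that case both \<open>F u\<close> and the first gap are
  \<open>\<infinity>\<close>: the additive form of the identity survives, while the subtractive form would read
  \<open>\<infinity> - \<infinity>\<close>.  Monotonicity follows from the additive form, as gaps are nonnegative by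
  Fenchel--Young.
\<close>

text \<open>
  If \<open>\<phi>\<close> were \<open>\<infinity>\<close> at a point with a subgradient, the subgradient inequality would make
  \<open>\<phi>\<close> identically \<open>\<infinity>\<close>, which properness excludes.
\<close>

lemma Phi_subdiff_finite:
  assumes "proper_on X \<phi>" "u \<in> X" "v \<in> Phi_subdiff X Y \<Phi> \<phi> u"
  shows "\<bar>\<phi> u\<bar> \<noteq> \<infinity>"
proof -
  obtain w where w: "w \<in> X" "\<phi> w \<noteq> \<infinity>"
    using assms(1) unfolding proper_on_def by blast
  have "\<phi> u + ereal (\<Phi> w v) - ereal (\<Phi> u v) \<le> \<phi> w"
    using assms(3) w(1) unfolding Phi_subdiff_def by blast
  with w(2) have "\<phi> u \<noteq> \<infinity>" by auto
  moreover have "\<phi> u \<noteq> - \<infinity>"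
    using assms(1,2) unfolding proper_on_def by blast
  ultimately show ?thesis by auto
qed

text \<open>
  The subgradient inequality at \<open>u\<close> says exactly that \<open>u\<close> maximizes \<open>\<Phi> w v - \<phi> w\<close> over \<open>w\<close>.
\<close>

lemma Phi_conj_at_subgradient:
  assumes "u \<in> X" "v \<in> Phi_subdiff X Y \<Phi> \<phi> u" "\<bar>\<phi> u\<bar> \<noteq> \<infinity>"
  shows "Phi_conj X \<Phi> \<phi> v = ereal (\<Phi> u v) - \<phi> u"
  unfolding Phi_conj_def
proof (rule antisym)
  show "(SUP w\<in>X. ereal (\<Phi> w v) - \<phi> w) \<le> ereal (\<Phi> u v) - \<phi> u"
  proof (rule SUP_least)
    fix w assume "w \<in> X"
    then have "\<phi> u + ereal (\<Phi> w v) - ereal (\<Phi> u v) \<le> \<phi> w"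
      using assms(2) unfolding Phi_subdiff_def by blast
    then show "ereal (\<Phi> w v) - \<phi> w \<le> ereal (\<Phi> u v) - \<phi> u"
      using assms(3) by (cases "\<phi> u"; cases "\<phi> w") auto
  qed
  show "ereal (\<Phi> u v) - \<phi> u \<le> (SUP w\<in>X. ereal (\<Phi> w v) - \<phi> w)"
    using assms(1) by (rule SUP_upper)
qed

text \<open>
  Nonnegativity of both gap functions.  For \<open>\<phi> u = \<infinity>\<close> the conjugate may be \<open>- \<infinity>\<close>; the
  inequality then rests on \<open>\<infinity> + (- \<infinity>) = \<infinity>\<close> in \<^typ>\<open>ereal\<close>.
\<close>

lemma Phi_Fenchel_Young:
  assumes "u \<in> X" "\<phi> u \<noteq> - \<infinity>"
  shows "0 \<le> \<phi> u + Phi_conj X \<Phi> \<phi> v - ereal (\<Phi> u v)"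
proof -
  have "ereal (\<Phi> u v) - \<phi> u \<le> Phi_conj X \<Phi> \<phi> v"
    unfolding Phi_conj_def using assms(1) by (rule SUP_upper)
  then show ?thesis
    using assms(2) by (cases "\<phi> u"; cases "Phi_conj X \<Phi> \<phi> v") auto
qed

lemma Phi_DCA_step_decrease:
  assumes g: "proper_on X g" and f: "proper_on X f"
    and u: "u \<in> X" and u': "u' \<in> X"
    and vf: "v \<in> Phi_subdiff X Y \<Phi> f u" and vg: "v \<in> Phi_subdiff X Y \<Phi> g u'"
    and fu': "\<bar>f u'\<bar> \<noteq> \<infinity>"
  shows "(g u' - f u') + (gap_g X \<Phi> g u v + gap_f X \<Phi> f v u') = g u - f u"
    and "g u \<noteq> \<infinity> \<Longrightarrow>
      g u' - f u' = (g u - f u) - (gap_g X \<Phi> g u v + gap_f X \<Phi> f v u')"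
    and "g u' - f u' \<le> g u - f u"
proof -
  have fu: "\<bar>f u\<bar> \<noteq> \<infinity>" using Phi_subdiff_finite[OF f u vf] .
  have gu': "\<bar>g u'\<bar> \<noteq> \<infinity>" using Phi_subdiff_finite[OF g u' vg] .
  have gu: "g u \<noteq> - \<infinity>" using g u unfolding proper_on_def by blast
  note gaps = gap_g_def gap_f_def
    Phi_conj_at_subgradient[OF u vf fu] Phi_conj_at_subgradient[OF u' vg gu']
  show sum: "(g u' - f u') + (gap_g X \<Phi> g u v + gap_f X \<Phi> f v u') = g u - f u"
    unfolding gaps using fu gu' gu fu'
    by (cases "f u"; cases "f u'"; cases "g u"; cases "g u'") auto
  show "g u' - f u' = (g u - f u) - (gap_g X \<Phi> g u v + gap_f X \<Phi> f v u')" if "g u \<noteq> \<infinity>"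
    unfolding gaps using that fu gu' gu fu'
    by (cases "f u"; cases "f u'"; cases "g u"; cases "g u'") auto
  have "0 \<le> gap_g X \<Phi> g u v + gap_f X \<Phi> f v u'"
    unfolding gap_g_def gap_f_def using u u' gu fu'
    by (intro add_nonneg_nonneg Phi_Fenchel_Young) auto
  then show "g u' - f u' \<le> g u - f u"
    unfolding sum[symmetric] by (rule ereal_le_add_self)
qed

theorem lemma5p3:
  fixes X :: "(real ^ 'n) set" and Y :: "(real ^ 'm) set"
    and \<Phi> :: "real ^ 'n \<Rightarrow> real ^ 'm \<Rightarrow> real"
    and f g F :: "real ^ 'n \<Rightarrow> ereal"
    and x :: "nat \<Rightarrow> real ^ 'n" and y :: "nat \<Rightarrow> real ^ 'm"
  assumes X_ne: "X \<noteq> {}" and Y_ne: "Y \<noteq> {}"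
    and Phi_cont: "continuous_on (X \<times> Y) (\<lambda>(u, v). \<Phi> u v)"
    and f_proper: "proper_on X f" and f_convex: "Phi_convex_on X Y \<Phi> f"
    and g_proper: "proper_on X g" and g_lsc: "lsc_on X g"
    and g_minorant: "\<exists>v\<in>Y. \<exists>\<beta>::real. \<forall>u\<in>X. g u \<ge> ereal (\<Phi> u v - \<beta>)"
    and F_def: "F = (\<lambda>u. g u - f u)"
    and F_inf: "- \<infinity> < (INF u\<in>X. F u)" "(INF u\<in>X. F u) < \<infinity>"
    and wd_g: "rge_on Y (Phi_subdiff_inv X Y \<Phi> g) \<noteq> {}"
      "rge_on Y (Phi_subdiff_inv X Y \<Phi> g) \<subseteq> dom_on X (Phi_subdiff X Y \<Phi> f)"
    and wd_f: "rge_on X (Phi_subdiff X Y \<Phi> f) \<noteq> {}"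
      "rge_on X (Phi_subdiff X Y \<Phi> f) \<subseteq> dom_on Y (Phi_subdiff_inv X Y \<Phi> g)"
    and iter: "Phi_DCA_iterates X Y \<Phi> g f x y"
  shows "(\<forall>k. (k = 0 \<longrightarrow> g (x 0) \<noteq> \<infinity>) \<longrightarrow>
            F (x (Suc k)) = F (x k) - (gap_g X \<Phi> g (x k) (y k) + gap_f X \<Phi> f (y k) (x (Suc k))))
       \<and> (\<forall>k. F (x (Suc k)) + (gap_g X \<Phi> g (x k) (y k) + gap_f X \<Phi> f (y k) (x (Suc k))) = F (x k))
       \<and> decseq (\<lambda>k. F (x k))"
proof -
  have yf: "y k \<in> Phi_subdiff X Y \<Phi> f (x k)" for k
    using iter unfolding Phi_DCA_iterates_def by blast
  have xg: "x (Suc k) \<in> X" "y k \<in> Phi_subdiff X Y \<Phi> g (x (Suc k))" for k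
    using iter unfolding Phi_DCA_iterates_def Phi_subdiff_inv_def by blast+
  have xX: "x k \<in> X" for k
  proof (cases k)
    case 0
    then show ?thesis using iter unfolding Phi_DCA_iterates_def dom_on_def by blast
  next
    case (Suc j)
    then show ?thesis using xg(1) by simp
  qed
  have f_fin: "\<bar>f (x k)\<bar> \<noteq> \<infinity>" for k
    using Phi_subdiff_finite[OF f_proper xX yf] .
  have g_fin: "g (x k) \<noteq> \<infinity>" if "k = 0 \<longrightarrow> g (x 0) \<noteq> \<infinity>" for k
  proof (cases k)
    case 0
    then show ?thesis using that by simp
  next
    case (Suc j)
    then show ?thesis using Phi_subdiff_finite[OF g_proper xg, of j] by auto
  qed
  note step = Phi_DCA_step_decrease[OF g_proper f_proper xX xX yf xg(2) f_fin]
  show ?thesis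
    unfolding F_def using step(1) step(2)[OF g_fin] step(3)
    by (blast intro: decseq_SucI)
qed

end
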